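(* Let $M\ge 2$ and $N,d\ge 1$ be integers. Let $Q_\tau\in\mathbb{R}^{N\times N}$ be entrywise non-negative and row-normalized (every row sums to $1$). For $m=1,\dots,M$ let $\gamma_m,\alpha_m,\beta_m>0$ satisfy $\gamma_m+\alpha_m+\beta_m=1$, and let $\gamma_{\min}=\min_m\gamma_m>0$. Given $H_0^{(1)},\dots,H_0^{(M)}\in\mathbb{R}^{N\times d}$, define for $k\ge 0$ $$\bar H_k^{(-m)}=\frac{1}{M-1}\sum_{n\ne m}H_k^{(n)},\qquad H_{k+1}^{(m)}=\gamma_m H_0^{(m)}+\alpha_m Q_\tau H_k^{(m)}+\beta_m Q_\tau \bar H_k^{(-m)},$$ and let $\mathbf{H}_k\in\mathbb{R}^{MN\times d}$ be the vertical stacking of $H_k^{(1)},\dots,H_k^{(M)}$. Let $P_\tau\in\mathbb{R}^{MN\times MN}$ be the stacked propagation matrix and $\Gamma\in\mathbb{R}^{MN\times MN}$ the residual matrix defined in the context. Then $$\mathbf{H}_{k+1}=P_\tau\mathbf{H}_k+\Gamma\mathbf{H}_0\quad\text{for all }k\ge 0,\qquad \rho(P_\tau)\le 1-\gamma_{\min}<1 .$$ Consequently $\{\mathbf{H}_k\}$ converges to the unique fixed point of the map $\mathbf{X}\mapsto P_\tau\mathbf{X}+\Gamma\mathbf{H}_0$, namely $$\mathbf{H}^*=(I-P_\tau)^{-1}\Gamma\mathbf{H}_0,$$ with asymptotic linear rate at most $1-\gamma_{\min}$, i.e. $\limsup_{k\to\infty}\|\mathbf{H}_k-\mathbf{H}^*\|^{1/k}\le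 1-\gamma_{\min}$.
   Context: $N$ is the number of graph nodes, $M$ the number of modalities, $d$ the hidden dimension. The task-context matrix $Q_\tau$ and the coefficients $\gamma_m,\alpha_m,\beta_m$ (outputs of a softmax, hence positive and summing to $1$) do not depend on the hop index $k$. Only the linear core of the propagation (no nonlinearity or normalization between hops) is considered. The matrix $P_\tau$ is the $M\times M$ block matrix with $N\times N$ blocks whose $(m,m)$ block is $\alpha_m Q_\tau$ and whose $(m,n)$ block, $n\neq m$, is $\frac{\beta_m}{M-1}Q_\tau$. The matrix $\Gamma$ is block diagonal with $m$-th diagonal block $\gamma_m I_N$. $\rho(\cdot)$ denotes spectral radius, $I$ the identity matrix of size $MN$, and $\|\cdot\|$ is any fixed matrix norm. *)

theory Defs
  imports
    "Jordan_Normal_Form.Spectral_Radius"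
    "Jordan_Normal_Form.Gauss_Jordan_Elimination"
    "HOL-Library.Extended_Real"
    "HOL-Library.Liminf_Limsup"
begin

text \<open>Modalities are indexed by \<open>0, \<dots>, M - 1\<close>. Index \<open>i\<close> of a block matrix whose blocks have
  \<open>p\<close> rows lies in block \<open>i div p\<close>, at position \<open>i mod p\<close>; likewise for columns.\<close>

definition block_matrix ::
    "nat \<Rightarrow> nat \<Rightarrow> nat \<Rightarrow> nat \<Rightarrow> (nat \<Rightarrow> nat \<Rightarrow> 'a mat) \<Rightarrow> 'a mat" where
  "block_matrix r c p q B =
     mat (r * p) (c * q) (\<lambda>(i, j). B (i div p) (j div q) $$ (i mod p, j mod q))"

definition vstack :: "nat \<Rightarrow> nat \<Rightarrow> nat \<Rightarrow> (nat \<Rightarrow> 'a mat) \<Rightarrow> 'a mat" where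
  "vstack M N d G = block_matrix M 1 N d (\<lambda>m _. G m)"

definition propagation_matrix ::
    "nat \<Rightarrow> nat \<Rightarrow> real mat \<Rightarrow> (nat \<Rightarrow> real) \<Rightarrow> (nat \<Rightarrow> real) \<Rightarrow> real mat" where
  "propagation_matrix M N Q \<alpha> \<beta> =
     block_matrix M M N N
       (\<lambda>m n. if m = n then \<alpha> m \<cdot>\<^sub>m Q else (\<beta> m / (real M - 1)) \<cdot>\<^sub>m Q)"

definition residual_matrix :: "nat \<Rightarrow> nat \<Rightarrow> (nat \<Rightarrow> real) \<Rightarrow> real mat" where
  "residual_matrix M N \<gamma> =
     block_matrix M M N N (\<lambda>m n. if m = n then \<gamma> m \<cdot>\<^sub>m 1\<^sub>m N else 0\<^sub>m N N)"

text \<open>The sum over the other modalities is written entrywise because the type of matrices,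
  having no global zero, is not an instance of \<^class>\<open>comm_monoid_add\<close>.\<close>

definition others_mean ::
    "nat \<Rightarrow> nat \<Rightarrow> nat \<Rightarrow> (nat \<Rightarrow> real mat) \<Rightarrow> nat \<Rightarrow> real mat" where
  "others_mean M N d G m =
     (1 / (real M - 1)) \<cdot>\<^sub>m mat N d (\<lambda>(i, j). \<Sum>n\<in>{..<M} - {m}. G n $$ (i, j))"

primrec hop ::
    "nat \<Rightarrow> nat \<Rightarrow> nat \<Rightarrow> real mat \<Rightarrow> (nat \<Rightarrow> real) \<Rightarrow> (nat \<Rightarrow> real) \<Rightarrow> (nat \<Rightarrow> real) \<Rightarrow>
     (nat \<Rightarrow> real mat) \<Rightarrow> nat \<Rightarrow> nat \<Rightarrow> real mat" where
  "hop M N d Q \<gamma> \<alpha> \<beta> H0 0 = H0"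
| "hop M N d Q \<gamma> \<alpha> \<beta> H0 (Suc k) =
     (\<lambda>m. \<gamma> m \<cdot>\<^sub>m H0 m
        + \<alpha> m \<cdot>\<^sub>m (Q * hop M N d Q \<gamma> \<alpha> \<beta> H0 k m)
        + \<beta> m \<cdot>\<^sub>m (Q * others_mean M N d (hop M N d Q \<gamma> \<alpha> \<beta> H0 k) m))"

text \<open>An arbitrary norm on the real vector space of \<open>nr \<times> nc\<close> matrices; submultiplicativity is not
  required (the matrices to be measured need not be square).\<close>

definition is_matrix_norm :: "nat \<Rightarrow> nat \<Rightarrow> (real mat \<Rightarrow> real) \<Rightarrow> bool" where
  "is_matrix_norm nr nc \<nu> \<longleftrightarrow>
     (\<forall>A\<in>carrier_mat nr nc. 0 \<le> \<nu> A \<and> (\<nu> A = 0 \<longleftrightarrow> A = 0\<^sub>m nr nc)) \<and>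
     (\<forall>A\<in>carrier_mat nr nc. \<forall>c. \<nu> (c \<cdot>\<^sub>m A) = \<bar>c\<bar> * \<nu> A) \<and>
     (\<forall>A\<in>carrier_mat nr nc. \<forall>B\<in>carrier_mat nr nc. \<nu> (A + B) \<le> \<nu> A + \<nu> B)"

end

theory Submission
  imports Defs
begin

text \<open>Every row of \<open>P\<close> has absolute sum \<open>\<alpha>\<^sub>m + \<beta>\<^sub>m = 1 - \<gamma>\<^sub>m \<le> 1 - \<gamma>\<^sub>m\<^sub>i\<^sub>n\<close>, so \<open>P\<close> contracts the maximum norm
  by the factor \<open>1 - \<gamma>\<^sub>m\<^sub>i\<^sub>n < 1\<close>. Evaluating an eigenvector at an entry of largest modulus bounds the
  spectral radius and excludes the eigenvalue 1; the error \<open>H\<^sub>k - H\<^sup>*\<close>, which \<open>P\<close> multiplies at every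
  hop, decays geometrically in every entry; and an arbitrary norm is at most a constant times the
  maximum norm.\<close>

section \<open>Indexing and multiplication of block matrices\<close>

lemma index_vstack:
  assumes "i < M * N" "j < d"
  shows "vstack M N d G $$ (i, j) = G (i div N) $$ (i mod N, j)"
  using assms by (simp add: vstack_def block_matrix_def)

lemma vstack_carrier: "vstack M N d G \<in> carrier_mat (M * N) d"
  by (simp add: vstack_def block_matrix_def)

text \<open>The range \<open>{..<M * N}\<close> is cut into \<open>M\<close> consecutive intervals
  of length \<open>N\<close>, each shifted back to start at 0. This turns sums over flat indices
  into sums over blocks and positions within them.\<close>

lemma sum_div_mod:
  fixes f :: "nat \<Rightarrow> nat \<Rightarrow> 'a::comm_monoid_add"
  assumes "N > 0"
  shows "(\<Sum>i<M * N. f (i div N) (i mod N)) = (\<Sum>m<M. \<Sum>r<N. f m r)"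
proof -
  have "(\<Sum>m<M. \<Sum>r<N. f m r) = (\<Sum>m<M. \<Sum>i = m * N..<m * N + N. f (i div N) (i mod N))"
  proof (rule sum.cong[OF refl])
    fix m
    have "(\<Sum>i = 0 + m * N..<N + m * N. f (i div N) (i mod N))
        = (\<Sum>r = 0..<N. f ((r + m * N) div N) ((r + m * N) mod N))"
      by (rule sum.shift_bounds_nat_ivl)
    also have "\<dots> = (\<Sum>r<N. f m r)"
      using assms by (auto simp: lessThan_atLeast0 intro!: sum.cong)
    finally show "(\<Sum>r<N. f m r) = (\<Sum>i = m * N..<m * N + N. f (i div N) (i mod N))"
      by (simp add: add.commute)
  qed
  then show ?thesis
    by (simp add: sum.nat_group)
qed

text \<open>The scalar product behind an entry runs over flat indices; regrouping it with
  \<open>sum_div_mod\<close> gives the usual rule for multiplying block matrices.\<close>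

lemma index_block_matrix_mult_vstack:
  fixes B :: "nat \<Rightarrow> nat \<Rightarrow> real mat"
  assumes "i < r * p" "j < d" "q > 0"
  shows "(block_matrix r c p q B * vstack c q d G) $$ (i, j)
    = (\<Sum>n<c. \<Sum>l<q. B (i div p) n $$ (i mod p, l) * G n $$ (l, j))"
proof -
  have "(block_matrix r c p q B * vstack c q d G) $$ (i, j)
      = (\<Sum>k<c * q. block_matrix r c p q B $$ (i, k) * vstack c q d G $$ (k, j))"
    using assms vstack_carrier[of c q d G]
    by (simp add: block_matrix_def scalar_prod_def lessThan_atLeast0)
  also have "\<dots> = (\<Sum>k<c * q. B (i div p) (k div q) $$ (i mod p, k mod q)
      * G (k div q) $$ (k mod q, j))"
    using assms by (intro sum.cong) (auto simp: index_vstack block_matrix_def)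
  also have "\<dots> = (\<Sum>n<c. \<Sum>l<q. B (i div p) n $$ (i mod p, l) * G n $$ (l, j))"
    using assms(3) by (rule sum_div_mod)
  finally show ?thesis .
qed

section \<open>Row sums, eigenvalues and inverses\<close>

text \<open>Triangle inequality in a single row. A general normed field serves both for complex
  eigenvectors and for the real columns of the error.\<close>

lemma norm_mult_mat_vec_le:
  fixes A :: "'a::real_normed_field mat"
  assumes "A \<in> carrier_mat n n" "v \<in> carrier_vec n" "i < n"
    and "(\<Sum>j<n. norm (A $$ (i, j))) \<le> c"
    and "\<And>j. j < n \<Longrightarrow> norm (v $ j) \<le> b" "0 \<le> b"
  shows "norm ((A *\<^sub>v v) $ i) \<le> c * b"
proof -
  have "norm ((A *\<^sub>v v) $ i) = norm (\<Sum>j<n. A $$ (i, j) * v $ j)"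
    using assms by (simp add: scalar_prod_def lessThan_atLeast0)
  also have "\<dots> \<le> (\<Sum>j<n. norm (A $$ (i, j)) * b)"
    using assms(5) by (intro sum_norm_le) (auto simp: norm_mult intro!: mult_left_mono)
  also have "\<dots> \<le> c * b"
    using assms(4,6) by (simp add: sum_distrib_right[symmetric] mult_right_mono)
  finally show ?thesis .
qed

lemma norm_eigenvalue_le_row_sum:
  fixes A :: "'a::real_normed_field mat"
  assumes A: "A \<in> carrier_mat n n" and v: "v \<in> carrier_vec n" "v \<noteq> 0\<^sub>v n"
    and eig: "A *\<^sub>v v = k \<cdot>\<^sub>v v"
    and rows: "\<And>i. i < n \<Longrightarrow> (\<Sum>j<n. norm (A $$ (i, j))) \<le> c"
  shows "norm k \<le> c"
proof -
  \<comment> \<open>A nonzero entry makes the index set nonempty, so that the maximum exists, and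
    forces the maximum to be positive, so that it can be cancelled.\<close>
  obtain l where l: "l < n" "v $ l \<noteq> 0"
    using v by (metis carrier_vecD eq_vecI index_zero_vec)
  let ?S = "(\<lambda>i. norm (v $ i)) ` {..<n}"
  have "Max ?S \<in> ?S"
    using l by (intro Max_in) auto
  then obtain i where i: "i < n" "norm (v $ i) = Max ?S"
    by auto
  have le: "norm (v $ j) \<le> norm (v $ i)" if "j < n" for j
    using that by (auto simp: i(2) intro!: Max_ge)
  have "norm k * norm (v $ i) = norm ((A *\<^sub>v v) $ i)"
    using eig v i(1) by (simp add: norm_mult)
  also have "\<dots> \<le> c * norm (v $ i)"
    using A v(1) i(1) rows[OF i(1)] le by (rule norm_mult_mat_vec_le) auto
  finally have "norm k * norm (v $ i) \<le> c * norm (v $ i)" .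
  moreover have "norm (v $ i) > 0"
    using le[OF l(1)] l(2) by (meson order_less_le_trans zero_less_norm_iff)
  ultimately show ?thesis
    by simp
qed

lemma spectral_radius_le_row_sum:
  fixes A :: "complex mat"
  assumes A: "A \<in> carrier_mat n n" "n > 0"
    and rows: "\<And>i. i < n \<Longrightarrow> (\<Sum>j<n. norm (A $$ (i, j))) \<le> c"
  shows "spectral_radius A \<le> c"
proof -
  \<comment> \<open>For \<open>n > 0\<close> the spectrum is nonempty, so the spectral radius is
    attained at an eigenvalue.\<close>
  obtain k where k: "k \<in> spectrum A" "spectral_radius A = norm k"
    using spectral_radius_mem_max(1)[OF A] by auto
  then obtain v where "v \<in> carrier_vec n" "v \<noteq> 0\<^sub>v n" "A *\<^sub>v v = k \<cdot>\<^sub>v v"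
    using A by (auto simp: spectrum_def eigenvalue_def eigenvector_def)
  then show ?thesis
    using norm_eigenvalue_le_row_sum[OF A(1)] rows k(2) by metis
qed

text \<open>A nonzero kernel vector of \<open>1\<^sub>m n - A\<close> would be an eigenvector of
  \<open>A\<close> for the eigenvalue 1, which row sums of at most \<open>c < 1\<close>
  exclude.\<close>

lemma inverse_one_minus_row_sum_less_one:
  fixes A :: "real mat"
  assumes A: "A \<in> carrier_mat n n"
    and rows: "\<And>i. i < n \<Longrightarrow> (\<Sum>j<n. \<bar>A $$ (i, j)\<bar>) \<le> c" and c: "c < 1"
  obtains B where "mat_inverse (1\<^sub>m n - A) = Some B" "B \<in> carrier_mat n n"
    "(1\<^sub>m n - A) * B = 1\<^sub>m n" "B * (1\<^sub>m n - A) = 1\<^sub>m n"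
proof -
  have IA: "1\<^sub>m n - A \<in> carrier_mat n n"
    using A by (rule minus_carrier_mat)
  have "det (1\<^sub>m n - A) \<noteq> 0"
  proof
    assume "det (1\<^sub>m n - A) = 0"
    then obtain v where v: "v \<in> carrier_vec n" "v \<noteq> 0\<^sub>v n" "(1\<^sub>m n - A) *\<^sub>v v = 0\<^sub>v n"
      using det_0_iff_vec_prod_zero_field[OF IA] by auto
    have "v - A *\<^sub>v v = 0\<^sub>v n"
      using v A by (simp add: minus_mult_distrib_mat_vec[of _ n n])
    then have "A *\<^sub>v v = 1 \<cdot>\<^sub>v v"
      using v(1) A
      by (intro eq_vecI) (auto dest!: arg_cong[of _ _ "\<lambda>w. w $ i" for i] simp: vec_eq_iff)
    from norm_eigenvalue_le_row_sum[OF A v(1,2) this, of c] rows c show False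
      by simp
  qed
  \<comment> \<open>A matrix with nonzero determinant is a unit of the matrix ring, and on a unit
    \<open>mat_inverse\<close> cannot return \<open>None\<close>.\<close>
  then have "1\<^sub>m n - A \<in> Units (ring_mat TYPE(real) n ())"
    by (rule det_non_zero_imp_unit[OF IA])
  then obtain B where B: "mat_inverse (1\<^sub>m n - A) = Some B"
    using mat_inverse(1)[OF IA, of "()"] by blast
  with mat_inverse(2)[OF IA B] that show thesis
    by blast
qed

section \<open>Arbitrary matrix norms and rates of convergence\<close>

text \<open>The norm is bounded by expanding \<open>A\<close> in the matrix units, one entry at a time.\<close>

lemma matrix_norm_le_entries:
  assumes \<nu>: "is_matrix_norm nr nc \<nu>"
  obtains K where "K > 0"
    "\<And>A b. A \<in> carrier_mat nr nc \<Longrightarrow> (\<And>i j. i < nr \<Longrightarrow> j < nc \<Longrightarrow> \<bar>A $$ (i, j)\<bar> \<le> b)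
      \<Longrightarrow> 0 \<le> b \<Longrightarrow> \<nu> A \<le> K * b"
proof -
  define E where "E p = mat nr nc (\<lambda>q. if q = p then 1 else 0 :: real)" for p
  define I where "I = {..<nr} \<times> {..<nc}"
  have nonneg: "0 \<le> \<nu> A" if "A \<in> carrier_mat nr nc" for A
    using \<nu> that by (auto simp: is_matrix_norm_def)
  have zero: "\<nu> (0\<^sub>m nr nc) = 0"
    using \<nu> by (auto simp: is_matrix_norm_def)
  have scale: "\<nu> (c \<cdot>\<^sub>m A) = \<bar>c\<bar> * \<nu> A" if "A \<in> carrier_mat nr nc" for c A
    using \<nu> that by (auto simp: is_matrix_norm_def)
  have triangle: "\<nu> (A + B) \<le> \<nu> A + \<nu> B"
    if "A \<in> carrier_mat nr nc" "B \<in> carrier_mat nr nc" for A B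
    using \<nu> that by (auto simp: is_matrix_norm_def)
  have E: "E p \<in> carrier_mat nr nc" for p
    by (simp add: E_def)
  \<comment> \<open>\<open>S\<close> holds the positions whose entries are kept, all others being
    replaced by 0; the triangle inequality is then applied by induction on \<open>S\<close>.\<close>
  have partial: "\<nu> (mat nr nc (\<lambda>q. if q \<in> S then A $$ q else 0)) \<le> (\<Sum>p\<in>S. \<bar>A $$ p\<bar> * \<nu> (E p))"
    if "finite S" for S A
    using that
  proof (induction S rule: finite_induct)
    case empty
    have "mat nr nc (\<lambda>q. if q \<in> {} then A $$ q else 0) = 0\<^sub>m nr nc"
      by auto
    then show ?case
      by (simp only: zero sum.empty order_refl)
  next
    case (insert p S)
    let ?A = "\<lambda>S. mat nr nc (\<lambda>q. if q \<in> S then A $$ q else 0)"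
    have "?A (insert p S) = A $$ p \<cdot>\<^sub>m E p + ?A S"
      using insert.hyps by (auto simp: E_def)
    then have "\<nu> (?A (insert p S)) \<le> \<nu> (A $$ p \<cdot>\<^sub>m E p) + \<nu> (?A S)"
      using triangle[of "A $$ p \<cdot>\<^sub>m E p" "?A S"] E by simp
    also have "\<dots> \<le> \<bar>A $$ p\<bar> * \<nu> (E p) + (\<Sum>p\<in>S. \<bar>A $$ p\<bar> * \<nu> (E p))"
      using insert.IH E by (simp add: scale)
    finally show ?case
      using insert.hyps by simp
  qed
  show thesis
  proof
    \<comment> \<open>The summand 1 keeps the constant positive even when \<open>I\<close> is
      empty.\<close>
    show "1 + (\<Sum>p\<in>I. \<nu> (E p)) > 0"
      using E by (intro add_pos_nonneg sum_nonneg nonneg) auto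
    fix A :: "real mat" and b :: real
    assume A: "A \<in> carrier_mat nr nc"
      and bound: "\<And>i j. i < nr \<Longrightarrow> j < nc \<Longrightarrow> \<bar>A $$ (i, j)\<bar> \<le> b" and b: "0 \<le> b"
    have "mat nr nc (\<lambda>q. if q \<in> I then A $$ q else 0) = A"
      using A by (auto simp: I_def)
    then have "\<nu> A \<le> (\<Sum>p\<in>I. \<bar>A $$ p\<bar> * \<nu> (E p))"
      using partial[of I A] by (simp add: I_def)
    also have "\<dots> \<le> (\<Sum>p\<in>I. b * \<nu> (E p))"
      using bound E by (intro sum_mono mult_right_mono nonneg) (auto simp: I_def)
    also have "\<dots> \<le> (1 + (\<Sum>p\<in>I. \<nu> (E p))) * b"
      using b by (simp add: sum_distrib_left algebra_simps)
    finally show "\<nu> A \<le> (1 + (\<Sum>p\<in>I. \<nu> (E p))) * b" .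
  qed
qed

text \<open>Since \<open>root k K\<close> tends to 1 for positive \<open>K\<close>, a constant
  factor does not affect the rate.\<close>

lemma limsup_root_le:
  fixes f :: "nat \<Rightarrow> real"
  assumes "\<And>k. f k \<le> K * c ^ k" "K > 0" "c \<ge> 0"
  shows "limsup (\<lambda>k. ereal (root k (f k))) \<le> ereal c"
proof -
  \<comment> \<open>Index 0 is left out: \<open>root 0\<close> is identically 0 by convention, so
    \<open>root k (c ^ k) = c\<close> can fail there.\<close>
  have "eventually (\<lambda>k. ereal (root k (f k)) \<le> ereal (root k K * c)) sequentially"
    using eventually_gt_at_top[of 0]
  proof eventually_elim
    case (elim k)
    have "root k (f k) \<le> root k (K * c ^ k)"
      using elim assms(1) by simp
    also have "\<dots> = root k K * c"
      using elim assms by (simp add: real_root_mult real_root_power_cancel)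
    finally show ?case
      by simp
  qed
  then have "limsup (\<lambda>k. ereal (root k (f k))) \<le> limsup (\<lambda>k. ereal (root k K * c))"
    by (rule Limsup_mono)
  also have "(\<lambda>k. root k K * c) \<longlonglongrightarrow> 1 * c"
    by (intro tendsto_mult LIMSEQ_root_const assms tendsto_const)
  then have "limsup (\<lambda>k. ereal (root k K * c)) = ereal c"
    by (intro lim_imp_Limsup) (auto intro: tendsto_ereal)
  finally show ?thesis .
qed

section \<open>The propagation matrix and the hop recursion\<close>

text \<open>All entries are non-negative, and each row of \<open>Q\<close> sums to 1, so only the
  scalar weights of the blocks remain: \<open>\<alpha> m\<close> once and
  \<open>\<beta> m / (real M - 1)\<close> for each of the \<open>M - 1\<close> other
  modalities.\<close>

lemma propagation_matrix_row_sum: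
  fixes Q :: "real mat"
  assumes "M \<ge> 2" "N \<ge> 1" "Q \<in> carrier_mat N N"
    and "\<And>i j. i < N \<Longrightarrow> j < N \<Longrightarrow> 0 \<le> Q $$ (i, j)"
    and "\<And>i. i < N \<Longrightarrow> (\<Sum>j<N. Q $$ (i, j)) = 1"
    and "\<And>m. m < M \<Longrightarrow> 0 \<le> \<alpha> m \<and> 0 \<le> \<beta> m" and i: "i < M * N"
  shows "(\<Sum>j<M * N. \<bar>propagation_matrix M N Q \<alpha> \<beta> $$ (i, j)\<bar>) = \<alpha> (i div N) + \<beta> (i div N)"
proof -
  \<comment> \<open>\<open>w m n\<close> is the scalar in front of \<open>Q\<close> in block
    \<open>(m, n)\<close>.\<close>
  define w where "w m n = (if m = n then \<alpha> m else \<beta> m / (real M - 1))" for m n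
  define m where "m = i div N"
  have m: "m < M" and im: "i mod N < N"
    using i assms(2) by (auto simp: m_def less_mult_imp_div_less)
  have w: "0 \<le> w m n" for n
    using assms(1,6) m by (auto simp: w_def)
  have "(\<Sum>j<M * N. \<bar>propagation_matrix M N Q \<alpha> \<beta> $$ (i, j)\<bar>)
      = (\<Sum>j<M * N. w m (j div N) * Q $$ (i mod N, j mod N))"
  proof (rule sum.cong[OF refl])
    fix j assume "j \<in> {..<M * N}"
    moreover have "j mod N < N"
      using assms(2) by simp
    moreover have "propagation_matrix M N Q \<alpha> \<beta> $$ (i, j)
        = w m (j div N) * Q $$ (i mod N, j mod N)"
      using calculation i im assms(3)
      by (simp add: propagation_matrix_def block_matrix_def w_def m_def)
    ultimately show "\<bar>propagation_matrix M N Q \<alpha> \<beta> $$ (i, j)\<bar>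
        = w m (j div N) * Q $$ (i mod N, j mod N)"
      using w im assms(4) by simp
  qed
  also have "\<dots> = (\<Sum>n<M. \<Sum>r<N. w m n * Q $$ (i mod N, r))"
    using assms(2) by (intro sum_div_mod) simp
  also have "\<dots> = (\<Sum>n<M. w m n)"
    using assms(5)[OF im] by (simp add: sum_distrib_left[symmetric])
  also have "\<dots> = w m m + (\<Sum>n\<in>{..<M} - {m}. w m n)"
    using m by (simp add: sum.remove)
  also have "(\<Sum>n\<in>{..<M} - {m}. w m n) = (\<Sum>n\<in>{..<M} - {m}. \<beta> m / (real M - 1))"
    by (intro sum.cong) (auto simp: w_def)
  also have "\<dots> = \<beta> m"
    using m assms(1) by (simp add: of_nat_diff)
  finally show ?thesis
    by (simp add: w_def m_def)
qed

text \<open>A case distinction suffices: a matrix sum takes its dimensions from the last summand,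
  here a multiple of \<open>Q * others_mean\<close>, whose second factor is \<open>N\<close> by
  \<open>d\<close> by construction.\<close>

lemma hop_carrier:
  assumes "Q \<in> carrier_mat N N" "H0 m \<in> carrier_mat N d"
  shows "hop M N d Q \<gamma> \<alpha> \<beta> H0 k m \<in> carrier_mat N d"
proof (cases k)
  case (Suc k')
  have "others_mean M N d G m \<in> carrier_mat N d" for G
    by (simp add: others_mean_def)
  then show ?thesis
    using assms Suc by (simp add: mult_carrier_mat)
qed (use assms in simp)

text \<open>Both sides are compared at row \<open>r\<close> of block \<open>m\<close>: the product
  with the propagation matrix yields the \<open>\<alpha>\<close> and \<open>\<beta>\<close> terms of
  the recursion, the product with the residual matrix the \<open>\<gamma>\<close> term.\<close>

lemma vstack_hop_Suc:
  assumes "N \<ge> 1" and Q: "Q \<in> carrier_mat N N"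
    and H0: "\<And>m. m < M \<Longrightarrow> H0 m \<in> carrier_mat N d"
  shows "vstack M N d (hop M N d Q \<gamma> \<alpha> \<beta> H0 (Suc k))
    = propagation_matrix M N Q \<alpha> \<beta> * vstack M N d (hop M N d Q \<gamma> \<alpha> \<beta> H0 k)
      + residual_matrix M N \<gamma> * vstack M N d H0"
proof (rule eq_matI)
  let ?G = "hop M N d Q \<gamma> \<alpha> \<beta> H0 k"
  fix i j
  assume "i < dim_row (propagation_matrix M N Q \<alpha> \<beta> * vstack M N d ?G
      + residual_matrix M N \<gamma> * vstack M N d H0)"
    and "j < dim_col (propagation_matrix M N Q \<alpha> \<beta> * vstack M N d ?G
      + residual_matrix M N \<gamma> * vstack M N d H0)"
  then have i: "i < M * N" and j: "j < d"
    by (simp_all add: residual_matrix_def block_matrix_def vstack_def)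
  define m r where "m = i div N" and "r = i mod N"
  have m: "m < M" and r: "r < N"
    using i assms(1) by (auto simp: m_def r_def less_mult_imp_div_less)
  have G: "?G n \<in> carrier_mat N d" if "n < M" for n
    using hop_carrier Q H0[OF that] by blast
  have oc: "others_mean M N d ?G m \<in> carrier_mat N d"
    by (simp add: others_mean_def)
  have "(propagation_matrix M N Q \<alpha> \<beta> * vstack M N d ?G) $$ (i, j)
     = (\<Sum>n<M. \<Sum>l<N. (if m = n then \<alpha> m \<cdot>\<^sub>m Q else (\<beta> m / (real M - 1)) \<cdot>\<^sub>m Q) $$ (r, l)
          * ?G n $$ (l, j))"
    unfolding propagation_matrix_def m_def r_def
    using i j assms(1) by (intro index_block_matrix_mult_vstack) auto
  \<comment> \<open>The diagonal block is split off from the blocks of the other modalities.\<close>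
  also have "\<dots> = (\<Sum>l<N. (\<alpha> m \<cdot>\<^sub>m Q) $$ (r, l) * ?G m $$ (l, j))
     + (\<Sum>n\<in>{..<M} - {m}. \<Sum>l<N. ((\<beta> m / (real M - 1)) \<cdot>\<^sub>m Q) $$ (r, l) * ?G n $$ (l, j))"
    using m by (subst sum.remove[of _ m]) (auto intro!: sum.cong)
  also have "(\<Sum>l<N. (\<alpha> m \<cdot>\<^sub>m Q) $$ (r, l) * ?G m $$ (l, j)) = \<alpha> m * (Q * ?G m) $$ (r, j)"
    using Q G[OF m] r j
    by (simp add: scalar_prod_def lessThan_atLeast0 sum_distrib_left mult.assoc)
  \<comment> \<open>With the sum over modalities innermost, it can be recognised as an entry of
    \<open>others_mean\<close>.\<close>
  also have "(\<Sum>n\<in>{..<M} - {m}. \<Sum>l<N. ((\<beta> m / (real M - 1)) \<cdot>\<^sub>m Q) $$ (r, l) * ?G n $$ (l, j))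
     = (\<Sum>l<N. \<Sum>n\<in>{..<M} - {m}. ((\<beta> m / (real M - 1)) \<cdot>\<^sub>m Q) $$ (r, l) * ?G n $$ (l, j))"
    by (rule sum.swap)
  also have "\<dots> = \<beta> m * (Q * others_mean M N d ?G m) $$ (r, j)"
    using Q oc r j
    by (simp add: scalar_prod_def lessThan_atLeast0 others_mean_def sum_distrib_left algebra_simps)
  finally have P: "(propagation_matrix M N Q \<alpha> \<beta> * vstack M N d ?G) $$ (i, j)
     = \<alpha> m * (Q * ?G m) $$ (r, j) + \<beta> m * (Q * others_mean M N d ?G m) $$ (r, j)" .
  have "(residual_matrix M N \<gamma> * vstack M N d H0) $$ (i, j)
     = (\<Sum>n<M. \<Sum>l<N. (if m = n then \<gamma> m \<cdot>\<^sub>m 1\<^sub>m N else 0\<^sub>m N N) $$ (r, l) * H0 n $$ (l, j))"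
    unfolding residual_matrix_def m_def r_def
    using i j assms(1) by (intro index_block_matrix_mult_vstack) auto
  \<comment> \<open>Two Kronecker deltas act here: only block \<open>n = m\<close> is nonzero, and
    in it only the column \<open>l = r\<close> of the identity.\<close>
  also have "\<dots> = (\<Sum>n<M. if n = m then (\<Sum>l<N. if l = r then \<gamma> m * H0 m $$ (r, j) else 0) else 0)"
  proof (rule sum.cong[OF refl])
    fix n
    have "(\<Sum>l<N. (\<gamma> m \<cdot>\<^sub>m 1\<^sub>m N) $$ (r, l) * H0 m $$ (l, j))
       = (\<Sum>l<N. if l = r then \<gamma> m * H0 m $$ (r, j) else 0)"
      using r by (intro sum.cong) auto
    moreover have "(\<Sum>l<N. (0\<^sub>m N N :: real mat) $$ (r, l) * H0 n $$ (l, j)) = 0"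
      using r by (intro sum.neutral) auto
    ultimately show "(\<Sum>l<N. (if m = n then \<gamma> m \<cdot>\<^sub>m 1\<^sub>m N else 0\<^sub>m N N) $$ (r, l) * H0 n $$ (l, j))
       = (if n = m then \<Sum>l<N. if l = r then \<gamma> m * H0 m $$ (r, j) else 0 else 0)"
      by (simp del: sum.delta sum.delta')
  qed
  also have "\<dots> = \<gamma> m * H0 m $$ (r, j)"
    using m r by simp
  finally have R: "(residual_matrix M N \<gamma> * vstack M N d H0) $$ (i, j) = \<gamma> m * H0 m $$ (r, j)" .
  have "vstack M N d (hop M N d Q \<gamma> \<alpha> \<beta> H0 (Suc k)) $$ (i, j)
     = \<gamma> m * H0 m $$ (r, j) + \<alpha> m * (Q * ?G m) $$ (r, j)
       + \<beta> m * (Q * others_mean M N d ?G m) $$ (r, j)"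
    using i j Q H0[OF m] G[OF m] oc r by (simp add: index_vstack m_def[symmetric] r_def[symmetric])
  moreover have "(propagation_matrix M N Q \<alpha> \<beta> * vstack M N d ?G
      + residual_matrix M N \<gamma> * vstack M N d H0) $$ (i, j)
     = (propagation_matrix M N Q \<alpha> \<beta> * vstack M N d ?G) $$ (i, j)
      + (residual_matrix M N \<gamma> * vstack M N d H0) $$ (i, j)"
    using i j by (intro index_add_mat) (auto simp: residual_matrix_def block_matrix_def vstack_def)
  ultimately show "vstack M N d (hop M N d Q \<gamma> \<alpha> \<beta> H0 (Suc k)) $$ (i, j)
    = (propagation_matrix M N Q \<alpha> \<beta> * vstack M N d ?G
      + residual_matrix M N \<gamma> * vstack M N d H0) $$ (i, j)"
    using P R by simp
qed (simp_all add: residual_matrix_def block_matrix_def vstack_def)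

section \<open>Geometric decay of the error\<close>

text \<open>Subtracting the fixed-point equation cancels \<open>C\<close> and leaves
  \<open>X (Suc k) - F = A * (X k - F)\<close>; each step multiplies the bound on the entries of a
  column by \<open>c\<close>.\<close>

lemma affine_iteration_error:
  fixes A :: "real mat"
  assumes A: "A \<in> carrier_mat n n" and X: "\<And>k. X k \<in> carrier_mat n d" and F: "F \<in> carrier_mat n d"
    and C: "C \<in> carrier_mat n d"
    and step: "\<And>k. X (Suc k) = A * X k + C" and fixpoint: "F = A * F + C"
    and rows: "\<And>i. i < n \<Longrightarrow> (\<Sum>j<n. \<bar>A $$ (i, j)\<bar>) \<le> c" and c: "0 \<le> c"
  obtains b where "0 \<le> b"
    "\<And>k i j. i < n \<Longrightarrow> j < d \<Longrightarrow> \<bar>(X k - F) $$ (i, j)\<bar> \<le> b * c ^ k"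
proof -
  \<comment> \<open>The sum dominates every initial error entry and, unlike a maximum, is also
    meaningful for an empty index set.\<close>
  define b where "b = (\<Sum>p\<in>{..<n} \<times> {..<d}. \<bar>(X 0 - F) $$ p\<bar>)"
  have b: "0 \<le> b"
    by (simp add: b_def sum_nonneg)
  have "\<bar>(X k - F) $$ (i, j)\<bar> \<le> b * c ^ k" if "i < n" "j < d" for k i j
    using that
  \<comment> \<open>The row must vary, since one entry of the next error involves a whole column of
    the current one.\<close>
  proof (induction k arbitrary: i j)
    case 0
    have "\<bar>(X 0 - F) $$ (i, j)\<bar> \<le> b"
      unfolding b_def using 0 by (intro member_le_sum) auto
    then show ?case
      by simp
  next
    case (Suc k)
    let ?D = "X k - F"
    have "X (Suc k) - F = (A * X k + C) - (A * F + C)"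
      using step fixpoint by metis
    also have "\<dots> = A * X k - A * F"
      using A X[of k] F C by (intro eq_matI) auto
    also have "\<dots> = A * ?D"
      using A X[of k] F by (simp add: mult_minus_distrib_mat)
    finally have "(X (Suc k) - F) $$ (i, j) = (A *\<^sub>v col ?D j) $ i"
      using A F X[of k] Suc.prems by simp
    moreover have "\<bar>\<dots>\<bar> \<le> c * (b * c ^ k)"
      using norm_mult_mat_vec_le[OF A _ Suc.prems(1), of "col ?D j" c "b * c ^ k"]
        rows[OF Suc.prems(1)] Suc.IH Suc.prems(2) b c F X[of k]
      by (auto simp: col_def)
    ultimately show ?case
      by (simp add: mult_ac)
  qed
  with b that show thesis
    by blast
qed

section \<open>Convergence of the hop iteration\<close>

theorem theorem1:
  fixes M N d :: nat
    and Q :: "real mat"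
    and \<gamma> \<alpha> \<beta> :: "nat \<Rightarrow> real"
    and H0 :: "nat \<Rightarrow> real mat"
  defines "P \<equiv> propagation_matrix M N Q \<alpha> \<beta>"
    and "\<Gamma> \<equiv> residual_matrix M N \<gamma>"
    and "\<gamma>min \<equiv> Min (\<gamma> ` {..<M})"
    and "H \<equiv> \<lambda>k. vstack M N d (hop M N d Q \<gamma> \<alpha> \<beta> H0 k)"
  defines "Hstar \<equiv> the (mat_inverse (1\<^sub>m (M * N) - P)) * (\<Gamma> * H 0)"
  assumes "M \<ge> 2" and "N \<ge> 1" and "d \<ge> 1"
    and "Q \<in> carrier_mat N N"
    and "\<And>i j. i < N \<Longrightarrow> j < N \<Longrightarrow> 0 \<le> Q $$ (i, j)"
    and "\<And>i. i < N \<Longrightarrow> (\<Sum>j<N. Q $$ (i, j)) = 1"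
    and "\<And>m. m < M \<Longrightarrow> \<gamma> m > 0 \<and> \<alpha> m > 0 \<and> \<beta> m > 0"
    and "\<And>m. m < M \<Longrightarrow> \<gamma> m + \<alpha> m + \<beta> m = 1"
    and "\<And>m. m < M \<Longrightarrow> H0 m \<in> carrier_mat N d"
  shows "(\<forall>k. H (Suc k) = P * H k + \<Gamma> * H 0)
    \<and> spectral_radius (map_mat complex_of_real P) \<le> 1 - \<gamma>min
    \<and> 1 - \<gamma>min < 1
    \<and> invertible_mat (1\<^sub>m (M * N) - P)
    \<and> Hstar \<in> carrier_mat (M * N) d
    \<and> (\<forall>X \<in> carrier_mat (M * N) d. X = P * X + \<Gamma> * H 0 \<longleftrightarrow> X = Hstar)
    \<and> (\<forall>i < M * N. \<forall>j < d. (\<lambda>k. H k $$ (i, j)) \<longlonglongrightarrow> Hstar $$ (i, j))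
    \<and> (\<forall>\<nu>. is_matrix_norm (M * N) d \<nu> \<longrightarrow>
          (\<lambda>k. \<nu> (H k - Hstar)) \<longlonglongrightarrow> 0
        \<and> limsup (\<lambda>k. ereal (root k (\<nu> (H k - Hstar)))) \<le> ereal (1 - \<gamma>min))"
proof -
  define n where "n = M * N"
  define c where "c = 1 - \<gamma>min"
  have n: "n > 0"
    using assms(6,7) by (simp add: n_def)
  have P: "P \<in> carrier_mat n n"
    by (simp add: P_def propagation_matrix_def block_matrix_def n_def)
  have \<Gamma>: "\<Gamma> \<in> carrier_mat n n"
    by (simp add: \<Gamma>_def residual_matrix_def block_matrix_def n_def)
  have H: "H k \<in> carrier_mat n d" for k
    by (simp add: H_def n_def vstack_carrier)
  have C: "\<Gamma> * H 0 \<in> carrier_mat n d"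
    using \<Gamma> H[of 0] by simp
  have \<gamma>_le: "\<gamma>min \<le> \<gamma> m" if "m < M" for m
    using that by (auto simp: \<gamma>min_def)
  \<comment> \<open>The minimum is attained at some \<open>m0\<close>; since the three positive
    coefficients sum to 1, \<open>\<gamma> m0\<close> lies strictly between 0 and 1, whence both
    bounds on \<open>c\<close>.\<close>
  have "\<gamma>min \<in> \<gamma> ` {..<M}"
    unfolding \<gamma>min_def using assms(6) by (intro Min_in) (auto simp: lessThan_empty_iff)
  then obtain m0 where "m0 < M" "\<gamma>min = \<gamma> m0"
    by auto
  with assms(12)[of m0] assms(13)[of m0] have c: "0 \<le> c" "c < 1"
    by (auto simp: c_def)
  have rows: "(\<Sum>j<n. \<bar>P $$ (i, j)\<bar>) \<le> c" if "i < n" for i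
  proof -
    have m: "i div N < M"
      using that by (simp add: n_def less_mult_imp_div_less)
    have "(\<Sum>j<n. \<bar>P $$ (i, j)\<bar>) = \<alpha> (i div N) + \<beta> (i div N)"
      unfolding P_def n_def
      using assms(6,7,9,10,11,12) that
      by (intro propagation_matrix_row_sum) (auto simp: n_def less_imp_le)
    also have "\<dots> \<le> c"
      using assms(13)[OF m] \<gamma>_le[OF m] by (simp add: c_def)
    finally show ?thesis .
  qed
  have step: "H (Suc k) = P * H k + \<Gamma> * H 0" for k
    unfolding H_def P_def \<Gamma>_def
    using vstack_hop_Suc[OF assms(7,9,14)] by simp
  \<comment> \<open>The embedding into the complex numbers preserves absolute values, hence the row
    sums.\<close>
  have radius: "spectral_radius (map_mat complex_of_real P) \<le> c"
    using P n rows by (intro spectral_radius_le_row_sum[of _ n]) auto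
  obtain B where B: "mat_inverse (1\<^sub>m n - P) = Some B" "B \<in> carrier_mat n n"
    "(1\<^sub>m n - P) * B = 1\<^sub>m n" "B * (1\<^sub>m n - P) = 1\<^sub>m n"
    using inverse_one_minus_row_sum_less_one[OF P rows c(2)] by blast
  \<comment> \<open>The inverse exists, so \<open>the\<close> in \<open>Hstar\<close> is applied to
    a \<open>Some\<close> and yields the actual inverse \<open>B\<close>.\<close>
  have Hstar_eq: "Hstar = B * (\<Gamma> * H 0)"
    using B(1) by (simp add: Hstar_def n_def)
  have Hstar: "Hstar \<in> carrier_mat n d"
    using B(2) C by (simp add: Hstar_eq)
  have IP: "1\<^sub>m n - P \<in> carrier_mat n n"
    using P by (rule minus_carrier_mat)
  have inv: "invertible_mat (1\<^sub>m n - P)"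
    using B P by (auto simp: invertible_mat_def inverts_mat_def square_mat.simps)
  have fixpoint: "X = P * X + \<Gamma> * H 0 \<longleftrightarrow> X = Hstar" if X: "X \<in> carrier_mat n d" for X
  proof -
    have PX: "P * X \<in> carrier_mat n d"
      using P X by simp
    have "X = Y + Z \<longleftrightarrow> X - Y = Z" if "Y \<in> carrier_mat n d" "Z \<in> carrier_mat n d" for Y Z
      using that X by (auto simp: mat_eq_iff diff_eq_eq add.commute)
    from this[OF PX C] have "X = P * X + \<Gamma> * H 0 \<longleftrightarrow> X - P * X = \<Gamma> * H 0" .
    also have "X - P * X = (1\<^sub>m n - P) * X"
      using P X by (simp add: minus_mult_distrib_mat[of _ n n])
    \<comment> \<open>That \<open>B\<close> is a left inverse gives uniqueness of the solution; that
      it is a right inverse gives existence.\<close>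
    also have "(1\<^sub>m n - P) * X = \<Gamma> * H 0 \<longleftrightarrow> X = Hstar"
    proof
      assume "(1\<^sub>m n - P) * X = \<Gamma> * H 0"
      then show "X = Hstar"
        using assoc_mult_mat[OF B(2) IP X] X B(4) by (simp add: Hstar_eq)
    next
      assume "X = Hstar"
      then show "(1\<^sub>m n - P) * X = \<Gamma> * H 0"
        using assoc_mult_mat[OF IP B(2) C] B(3) left_mult_one_mat[OF C] by (simp add: Hstar_eq)
    qed
    finally show ?thesis .
  qed
  \<comment> \<open>Reading \<open>fixpoint\<close> at \<open>Hstar\<close> itself supplies the
    fixed-point equation that the error estimate requires.\<close>
  obtain b where b: "0 \<le> b"
    "\<And>k i j. i < n \<Longrightarrow> j < d \<Longrightarrow> \<bar>(H k - Hstar) $$ (i, j)\<bar> \<le> b * c ^ k"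
    using affine_iteration_error[where X = H, OF P H Hstar C step iffD2[OF fixpoint[OF Hstar] refl]
        rows c(1)] by blast
  have geometric: "(\<lambda>k. c ^ k) \<longlonglongrightarrow> 0"
    using c by (intro LIMSEQ_power_zero) simp
  have entries: "(\<lambda>k. H k $$ (i, j)) \<longlonglongrightarrow> Hstar $$ (i, j)" if "i < n" "j < d" for i j
  proof -
    have "(\<lambda>k. H k $$ (i, j) - Hstar $$ (i, j)) \<longlonglongrightarrow> 0"
    proof (rule tendsto_0_le[OF geometric])
      show "\<forall>\<^sub>F k in sequentially. norm (H k $$ (i, j) - Hstar $$ (i, j)) \<le> norm (c ^ k) * b"
        using b(2)[OF that] that Hstar c(1)
        by (intro always_eventually) (auto simp: mult.commute)
    qed
    then show ?thesis
      by (rule LIM_zero_cancel)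
  qed
  have norms: "(\<lambda>k. \<nu> (H k - Hstar)) \<longlonglongrightarrow> 0
      \<and> limsup (\<lambda>k. ereal (root k (\<nu> (H k - Hstar)))) \<le> ereal c"
    if \<nu>: "is_matrix_norm n d \<nu>" for \<nu>
  proof -
    have D: "H k - Hstar \<in> carrier_mat n d" for k
      using Hstar by (rule minus_carrier_mat)
    obtain K where K: "K > 0"
      "\<And>A b. A \<in> carrier_mat n d \<Longrightarrow> (\<And>i j. i < n \<Longrightarrow> j < d \<Longrightarrow> \<bar>A $$ (i, j)\<bar> \<le> b)
        \<Longrightarrow> 0 \<le> b \<Longrightarrow> \<nu> A \<le> K * b"
      using matrix_norm_le_entries[OF \<nu>] by blast
    have le: "\<nu> (H k - Hstar) \<le> K * (b * c ^ k)" for k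
      using D b c(1) by (intro K(2)) auto
    have "(\<lambda>k. \<nu> (H k - Hstar)) \<longlonglongrightarrow> 0"
    proof (rule tendsto_0_le[OF geometric])
      have "0 \<le> \<nu> (H k - Hstar)" for k
        using \<nu> D by (simp add: is_matrix_norm_def)
      then show "\<forall>\<^sub>F k in sequentially. norm (\<nu> (H k - Hstar)) \<le> norm (c ^ k) * (K * b)"
        using le c(1) by (intro always_eventually) (simp add: mult_ac)
    qed
    \<comment> \<open>\<open>b\<close> may be 0, for instance when the iteration starts at the fixed
      point, while \<open>limsup_root_le\<close> asks for a positive constant; hence
      \<open>b + 1\<close>.\<close>
    moreover have "\<nu> (H k - Hstar) \<le> (K * (b + 1)) * c ^ k" for k
    proof -
      have "K * (b * c ^ k) \<le> (K * (b + 1)) * c ^ k"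
        using K(1) c(1) by (simp add: algebra_simps)
      with le[of k] show ?thesis
        by linarith
    qed
    then have "limsup (\<lambda>k. ereal (root k (\<nu> (H k - Hstar)))) \<le> ereal c"
      using K(1) b(1) c(1) by (intro limsup_root_le[of _ "K * (b + 1)"]) auto
    ultimately show ?thesis ..
  qed
  show ?thesis
    using step radius c(2) inv Hstar fixpoint entries norms
    unfolding n_def c_def by blast
qed

end
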